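(* Let $(r,\rho)\in\mathcal{NC}$. (1) The shift map $\sigma_{r,\rho}$ is a transitive map on $M_{r,\rho}$ (which is a Lelek fan). (2) There are points $\mathbf x=(x_1,x_2,x_3,\ldots)\in M_{r,\rho}$ such that $\frac{x_1}{r}\neq\frac{x_1}{\rho}$ and $\frac{x_1}{r},\frac{x_1}{\rho}\in[0,1]$, and for such points $$\sigma_{r,\rho}\Big(\frac{x_1}{r},x_1,x_2,x_3,\ldots\Big)=\mathbf x\quad\text{and}\quad \sigma_{r,\rho}\Big(\frac{x_1}{\rho},x_1,x_2,x_3,\ldots\Big)=\mathbf x .$$ Therefore, the map $\sigma_{r,\rho}$ is not a homeomorphism.
   Context: $(r,\rho)\in\mathcal{NC}$ means: $r,\rho\in(0,\infty)$, $r<1$, $\rho>1$, and for all integers $k,\ell$, $r^k=\rho^\ell$ if and only if $k=\ell=0$. Put $L_{r,\rho}=\{(x,y)\in[0,1]^2 : y=rx\}\cup\{(x,y)\in[0,1]^2: y=\rho x\}$ and $$M_{r,\rho}=\Big\{(x_1,x_2,x_3,\ldots)\in\prod_{i=1}^\infty[0,1] : (x_i,x_{i+1})\in L_{r,\rho}\text{ for each } i\ge 1\Big\},$$ with the subspace topology of the Hilbert cube. The map $\sigma_{r,\rho}:M_{r,\rho}\to M_{r,\rho}$ is the shift $\sigma_{r,\rho}(x_1,x_2,x_3,\ldots)=(x_2,x_3,\ldots)$. A continuous map $f:X\to X$ is transitive if for all non-empty open sets $U,V\subseteq X$ there is a non-negative integer $n$ with $f^n(U)\cap V\neq\emptyset$.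 It is known from earlier work (and may be taken as given) that $M_{r,\rho}$ is a Lelek fan, i.e. a smooth fan whose set of end-points is dense. *)

theory Defs
  imports "HOL-Analysis.Analysis"
begin

text \<open>
  Spaces are subsets of a metric space type, carrying the subspace topology.
\<close>

definition continuum :: "'a::metric_space set \<Rightarrow> bool" where
  "continuum X \<longleftrightarrow> X \<noteq> {} \<and> compact X \<and> connected X"

definition hereditarily_unicoherent :: "'a::metric_space set \<Rightarrow> bool" where
  "hereditarily_unicoherent X \<longleftrightarrow> (\<forall>K. K \<subseteq> X \<and> continuum K \<longrightarrow> unicoherent K)"

definition arcwise_connected :: "'a::metric_space set \<Rightarrow> bool" where
  "arcwise_connected X \<longleftrightarrow>
     (\<forall>x\<in>X. \<forall>y\<in>X. x \<noteq> y \<longrightarrow>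
        (\<exists>g. arc g \<and> path_image g \<subseteq> X \<and> pathstart g = x \<and> pathfinish g = y))"

definition dendroid :: "'a::metric_space set \<Rightarrow> bool" where
  "dendroid X \<longleftrightarrow> continuum X \<and> arcwise_connected X \<and> hereditarily_unicoherent X"

definition end_points :: "'a::metric_space set \<Rightarrow> 'a set" where
  "end_points X =
     {x \<in> X. \<forall>g. arc g \<and> path_image g \<subseteq> X \<and> x \<in> path_image g \<longrightarrow>
                 x = pathstart g \<or> x = pathfinish g}"

text \<open>
  The three arcs below form a simple triod in \<open>X\<close> with top point \<open>x\<close>.
\<close>

definition ramification_points :: "'a::metric_space set \<Rightarrow> 'a set" where
  "ramification_points X =
     {x \<in> X. \<exists>g1 g2 g3.
        (\<forall>g\<in>{g1, g2, g3}. arc g \<and> path_image g \<subseteq> X \<and> pathstart g = x) \<and>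
        path_image g1 \<inter> path_image g2 = {x} \<and>
        path_image g1 \<inter> path_image g3 = {x} \<and>
        path_image g2 \<inter> path_image g3 = {x}}"

definition fan_with_top :: "'a::metric_space set \<Rightarrow> 'a \<Rightarrow> bool" where
  "fan_with_top X v \<longleftrightarrow> dendroid X \<and> ramification_points X = {v}"

text \<open>
  \<open>A\<close> is an arc in \<open>X\<close> from \<open>v\<close> to \<open>x\<close>, where the arc from \<open>v\<close> to itself is \<open>{v}\<close>.
  In a dendroid there is exactly one such \<open>A\<close>.
\<close>

definition is_arc_from_to :: "'a::metric_space set \<Rightarrow> 'a \<Rightarrow> 'a \<Rightarrow> 'a set \<Rightarrow> bool" where
  "is_arc_from_to X v x A \<longleftrightarrow> A \<subseteq> X \<and>
     (if x = v then A = {v}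
      else (\<exists>g. arc g \<and> path_image g = A \<and> pathstart g = v \<and> pathfinish g = x))"

text \<open>
  Convergence in the Hausdorff metric on non-empty compact sets.
\<close>

definition hausdorff_tendsto :: "(nat \<Rightarrow> 'a::metric_space set) \<Rightarrow> 'a set \<Rightarrow> bool" where
  "hausdorff_tendsto A B \<longleftrightarrow>
     (\<forall>e>0. \<forall>\<^sub>F n in sequentially.
        (\<forall>a\<in>A n. \<exists>b\<in>B. dist a b < e) \<and> (\<forall>b\<in>B. \<exists>a\<in>A n. dist a b < e))"

definition smooth_at :: "'a::metric_space set \<Rightarrow> 'a \<Rightarrow> bool" where
  "smooth_at X v \<longleftrightarrow>
     (\<forall>xs x A B. (\<forall>n. xs n \<in> X) \<and> x \<in> X \<and> xs \<longlonglongrightarrow> x \<and>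
        (\<forall>n::nat. is_arc_from_to X v (xs n) (A n)) \<and> is_arc_from_to X v x B \<longrightarrow>
        hausdorff_tendsto A B)"

definition Lelek_fan :: "'a::metric_space set \<Rightarrow> bool" where
  "Lelek_fan X \<longleftrightarrow>
     (\<exists>v. fan_with_top X v \<and> smooth_at X v) \<and> X \<subseteq> closure (end_points X)"

definition transitive_map :: "'a::topological_space set \<Rightarrow> ('a \<Rightarrow> 'a) \<Rightarrow> bool" where
  "transitive_map X f \<longleftrightarrow> continuous_on X f \<and> f ` X \<subseteq> X \<and>
     (\<forall>U V. openin (top_of_set X) U \<and> U \<noteq> {} \<and> openin (top_of_set X) V \<and> V \<noteq> {} \<longrightarrow>
        (\<exists>n::nat. (f ^^ n) ` U \<inter> V \<noteq> {}))"

definition NC :: "real \<Rightarrow> real \<Rightarrow> bool" where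
  "NC r \<rho> \<longleftrightarrow> 0 < r \<and> 0 < \<rho> \<and> r < 1 \<and> \<rho> > 1 \<and>
     (\<forall>k l :: int. r powi k = \<rho> powi l \<longleftrightarrow> k = 0 \<and> l = 0)"

definition L_rel :: "real \<Rightarrow> real \<Rightarrow> (real \<times> real) set" where
  "L_rel r \<rho> = {(x, y) \<in> {0..1} \<times> {0..1}. y = r * x} \<union> {(x, y) \<in> {0..1} \<times> {0..1}. y = \<rho> * x}"

text \<open>
  Sequences are indexed from \<open>0\<close>, so \<open>x i\<close> is the coordinate \<open>x\<^sub>i\<^sub>+\<^sub>1\<close>. The type
  \<open>nat \<Rightarrow> real\<close> carries the product topology, which induces the topology of the Hilbert cube
  on \<open>[0,1]\<close>-valued sequences; its library metric generates this topology.
\<close>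

definition M_space :: "real \<Rightarrow> real \<Rightarrow> (nat \<Rightarrow> real) set" where
  "M_space r \<rho> = {x. (\<forall>i. x i \<in> {0..1}) \<and> (\<forall>i. (x i, x (Suc i)) \<in> L_rel r \<rho>)}"

definition seq_shift :: "(nat \<Rightarrow> real) \<Rightarrow> nat \<Rightarrow> real" where
  "seq_shift x = (\<lambda>i. x (Suc i))"

definition prepend :: "real \<Rightarrow> (nat \<Rightarrow> real) \<Rightarrow> nat \<Rightarrow> real" where
  "prepend a x = (\<lambda>i. case i of 0 \<Rightarrow> a | Suc j \<Rightarrow> x j)"

end

theory Submission
  imports Defs
begin

text \<open>
  A point of \<open>M\<close> is determined by its first coordinate and the slopes (\<open>r\<close> or \<open>\<rho>\<close>) it follows, so \<open>M\<close>
  is a union of straight legs \<open>{c \<cdot> x | 0 \<le> c \<le> 1}\<close> meeting only at \<open>0\<close>. A closed connected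
  subset containing two points contains every leg point between them: otherwise it could be split
  by the first coordinate together with finitely many slopes. This one fact yields
  hereditary unicoherence, the unique arcs from \<open>0\<close>, smoothness, the single ramification point, and
  that points with supremum \<open>1\<close> are end-points. Density of \<open>{r\<^sup>k \<rho>\<^sup>l | k l \<in> \<nat>}\<close> in the
  positive reals (Kronecker) lets any finite
  beginning of a non-zero point be continued, first descending by \<open>r\<close> and then climbing by \<open>\<rho>\<close>, to a point
  arbitrarily close to any other non-zero point. This gives transitivity and, by Baire's theorem, density of the
  points with supremum \<open>1\<close>.
\<close>

section \<open>Convergence in the product and relatively open sets\<close>

lemma tendsto_coordinatewise_then_fun:
  fixes f :: "'a \<Rightarrow> 'i \<Rightarrow> 'b::topological_space"
  assumes "\<And>i. ((\<lambda>n. f n i) \<longlongrightarrow> x i) F"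
  shows "(f \<longlongrightarrow> x) F"
proof -
  have "limitin (product_topology (\<lambda>i. euclidean) UNIV) f x F"
    unfolding limitin_componentwise using assms by auto
  then show ?thesis
    by (simp add: euclidean_product_topology)
qed

lemma continuous_on_product_coordinate [continuous_intros]:
  "continuous_on S (\<lambda>x. x i :: 'b::topological_space)"
  by (rule continuous_on_subset[OF continuous_on_product_coordinates subset_UNIV])

lemma openin_eventually_mem:
  assumes "openin (top_of_set M) U" "x \<in> U" "(f \<longlongrightarrow> x) F" "\<forall>n. f n \<in> M"
  shows "\<forall>\<^sub>F n in F. f n \<in> U"
proof -
  obtain T where T: "open T" "U = M \<inter> T"
    using assms(1) by (auto simp: openin_open)
  then have "\<forall>\<^sub>F n in F. f n \<in> T"
    using topological_tendstoD[OF assms(3)] assms(2) by auto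
  then show ?thesis
    by eventually_elim (use assms(4) T in auto)
qed

section \<open>Scaling of sequences and straight legs\<close>

definition scl :: "real \<Rightarrow> (nat \<Rightarrow> real) \<Rightarrow> nat \<Rightarrow> real" where
  "scl c x = (\<lambda>i. c * x i)"

lemma scl_apply [simp]: "scl c x i = c * x i"
  by (simp add: scl_def)

lemma scl_scl [simp]: "scl c (scl d x) = scl (c * d) x"
  by (auto simp: scl_def)

lemma scl_1 [simp]: "scl 1 x = x"
  by (auto simp: scl_def)

lemma scl_0 [simp]: "scl 0 x = (\<lambda>_. 0)"
  by (auto simp: scl_def)

lemma scl_eq_iff: "x 0 \<noteq> 0 \<Longrightarrow> scl c x = scl d x \<longleftrightarrow> c = d"
  by (auto simp: fun_eq_iff scl_def)

lemma scl_eq_iff' [simp]: "x 0 \<noteq> 0 \<Longrightarrow> scl c x = x \<longleftrightarrow> c = 1" "x 0 \<noteq> 0 \<Longrightarrow> x = scl c x \<longleftrightarrow> c = 1"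
  using scl_eq_iff[of x c 1] scl_eq_iff[of x 1 c] by auto

lemma continuous_on_scl [continuous_intros]:
  "continuous_on S f \<Longrightarrow> continuous_on S (\<lambda>t. scl (f t) x)"
  unfolding scl_def by (intro continuous_intros)

lemma tendsto_scl [tendsto_intros]: "(f \<longlongrightarrow> c) F \<Longrightarrow> ((\<lambda>t. scl (f t) x) \<longlongrightarrow> scl c x) F"
  unfolding scl_def by (intro tendsto_coordinatewise_then_fun tendsto_intros)

lemma connected_scl_image: "connected S \<Longrightarrow> connected ((\<lambda>c. scl c x) ` S)"
  by (intro connected_continuous_image continuous_intros)

lemma mem_scl_image: "1 \<in> S \<Longrightarrow> x \<in> (\<lambda>c. scl c x) ` S"
  by (rule image_eqI[of _ _ 1]) auto

text \<open>The metric is a weighted sum of truncated coordinate distances, and a factor in [0,1]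
  shrinks every summand. Smoothness uses this to compare two legs at equal parameters.\<close>

lemma dist_scl_le:
  assumes "0 \<le> c" "c \<le> 1"
  shows "dist (scl c x) (scl c y) \<le> dist x y"
proof -
  have sm: "summable (\<lambda>n. (1/2)^n * min (dist (u (from_nat n)) (v (from_nat n))) 1)"
    for u v :: "nat \<Rightarrow> real"
    by (rule summable_comparison_test'[of "\<lambda>n. (1/2)^n"]) auto
  have "dist (c * a) (c * b) \<le> dist a b" for a b :: real
    using assms mult_left_le_one_le[of "\<bar>a - b\<bar>" c]
    by (simp add: dist_real_def abs_mult flip: right_diff_distrib)
  then have "min (dist (c * a) (c * b)) 1 \<le> min (dist a b) 1" for a b :: real
    by (meson min.mono order_refl)
  then show ?thesis
    unfolding dist_fun_def by (intro suminf_le sm) (auto intro!: mult_left_mono)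
qed

lemma arc_scl:
  assumes "x 0 \<noteq> 0" "a \<noteq> b"
  shows "arc (\<lambda>t. scl (linepath a b t) x)"
proof -
  have "t = u" if "scl (linepath a b t) x = scl (linepath a b u) x" for t u
  proof -
    have "linepath a b t = linepath a b u"
      using that scl_eq_iff[of x] assms by blast
    then have "(t - u) * (b - a) = 0"
      by (simp add: linepath_def algebra_simps)
    then show ?thesis using assms by simp
  qed
  then have "inj_on (\<lambda>t. scl (linepath a b t) x) {0..1}"
    by (auto intro: inj_onI)
  moreover have "path (\<lambda>t. scl (linepath a b t) x)"
    unfolding path_def by (intro continuous_intros)
  ultimately show ?thesis
    by (simp add: arc_def)
qed

lemma path_image_scl:
  "path_image (\<lambda>t. scl (linepath a b t) x) = (\<lambda>c. scl c x) ` closed_segment a b"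
  unfolding path_image_def linepath_image_01[symmetric] by (simp add: image_image)

lemma path_ends_scl:
  "pathstart (\<lambda>t. scl (linepath a b t) x) = scl a x"
  "pathfinish (\<lambda>t. scl (linepath a b t) x) = scl b x"
  by (simp_all add: pathstart_def pathfinish_def linepath_def)

section \<open>Cutting arcs, and leg-convex sets\<close>

text \<open>Injectivity leaves \<open>g t\<close> as the only common point of the two pieces, so a
  point that leg-convexity puts into both of them must be \<open>g t\<close>.\<close>

lemma arc_split:
  fixes g :: "real \<Rightarrow> 'a::metric_space"
  assumes "arc g" "t \<in> {0..1}"
  shows "connected (g ` {0..t})" "connected (g ` {t..1})"
    "closed (g ` {0..t})" "closed (g ` {t..1})"
    "g ` {0..t} \<subseteq> path_image g" "g ` {t..1} \<subseteq> path_image g"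
    "g ` {0..t} \<inter> g ` {t..1} = {g t}"
proof -
  have "continuous_on {0..1} g" "inj_on g {0..1}"
    using assms by (auto simp: arc_def path_def)
  then have *: "continuous_on {0..t} g" "continuous_on {t..1} g"
    using assms by (auto intro: continuous_on_subset)
  then show "connected (g ` {0..t})" "connected (g ` {t..1})"
    by (auto intro: connected_continuous_image)
  show "closed (g ` {0..t})" "closed (g ` {t..1})"
    using * by (auto intro: compact_imp_closed compact_continuous_image)
  show "g ` {0..t} \<subseteq> path_image g" "g ` {t..1} \<subseteq> path_image g"
    using assms by (auto simp: path_image_def)
  have "g ` {0..t} \<inter> g ` {t..1} = g ` ({0..t} \<inter> {t..1})"
    using assms by (intro inj_on_image_Int[symmetric, OF \<open>inj_on g {0..1}\<close>]) auto
  also have "{0..t} \<inter> {t..1} = {t}"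
    using assms by auto
  finally show "g ` {0..t} \<inter> g ` {t..1} = {g t}"
    by simp
qed

text \<open>
  If \<open>y = scl d x\<close> with \<open>d < c\<close>, or if \<open>y\<close> lies on a different leg, then \<open>scl c x\<close> separates
  \<open>x\<close> from \<open>y\<close> in \<open>M\<close>.
\<close>

definition leg_convex :: "(nat \<Rightarrow> real) set \<Rightarrow> bool" where
  "leg_convex D \<longleftrightarrow>
     (\<forall>x\<in>D. \<forall>y\<in>D. \<forall>c. 0 < c \<and> c < 1 \<and> (\<forall>d>c. y \<noteq> scl d x) \<longrightarrow> scl c x \<in> D)"

lemma leg_convexD:
  "leg_convex D \<Longrightarrow> x \<in> D \<Longrightarrow> y \<in> D \<Longrightarrow> 0 < c \<Longrightarrow> c < 1 \<Longrightarrow> (\<And>d. d > c \<Longrightarrow> y \<noteq> scl d x)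
    \<Longrightarrow> scl c x \<in> D"
  unfolding leg_convex_def by blast

lemma leg_convex_Int: "leg_convex C \<Longrightarrow> leg_convex D \<Longrightarrow> leg_convex (C \<inter> D)"
  unfolding leg_convex_def by blast

text \<open>As \<open>y\<close> is no positive multiple of \<open>x\<close>, every factor in (0,1)
  is admissible in \<open>leg_convex\<close>; the factor 0 follows by closedness as a limit.\<close>

lemma leg_convex_to_zero:
  assumes "leg_convex D" "closed D" "x \<in> D" "y \<in> D" "\<And>d. d > 0 \<Longrightarrow> y \<noteq> scl d x" "0 \<le> c" "c \<le> 1"
  shows "scl c x \<in> D"
proof -
  have pos: "scl c x \<in> D" if "0 < c" "c < 1" for c
    using leg_convexD[OF assms(1,3,4)] that assms(5) by auto
  have "scl 0 x \<in> D"
  proof (rule closed_sequentially[OF \<open>closed D\<close>])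
    show "(\<lambda>n. scl (inverse (real (Suc (Suc n)))) x) \<longlonglongrightarrow> scl 0 x"
      using LIMSEQ_Suc[OF LIMSEQ_inverse_real_of_nat] by (intro tendsto_intros)
    show "scl (inverse (real (Suc (Suc n)))) x \<in> D" for n
      by (rule pos) (auto simp: field_simps)
  qed
  then show ?thesis
    using assms pos[of c] by (cases "c = 0"; cases "c = 1") auto
qed

text \<open>Positive multiples of one point are joined by the segment between them, any other two
  points by their legs through 0; both connections stay in \<open>D\<close>. For subsets of
  \<open>M\<close> the converse is \<open>leg_convex_if_connected\<close>.\<close>

lemma connected_if_leg_convex:
  assumes "leg_convex D" "closed D"
  shows "connected D"
proof -
  have leg: "\<exists>K. connected K \<and> K \<subseteq> D \<and> x \<in> K \<and> scl d x \<in> K"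
    if "x \<in> D" "scl d x \<in> D" "0 < d" "d \<le> 1" for x d
  \<comment> \<open>The point 0 is set apart: all its multiples coincide, so no \<open>c\<close>
    meets the side condition of \<open>leg_convex\<close>.\<close>
  proof (cases "x 0 = 0 \<and> scl d x = x")
    case True
    then show ?thesis using that by (intro exI[of _ "{x}"]) auto
  next
    case False
    have "scl c x \<in> D" if c: "d \<le> c" "c \<le> 1" for c
    proof (cases "c = d \<or> c = 1")
      case True
      then show ?thesis using \<open>x \<in> D\<close> \<open>scl d x \<in> D\<close> by auto
    next
      case F: False
      have "scl d x \<noteq> scl e x" if "e > c" for e
      proof
        assume eq: "scl d x = scl e x"
        have "x i = 0" for i
          using fun_cong[OF eq, of i] that c by auto
        then have "x = (\<lambda>_. 0)"
          by auto
        then show False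
          using False by (auto simp: scl_def)
      qed
      then show ?thesis
        using F c \<open>0 < d\<close> by (intro leg_convexD[OF assms(1) \<open>x \<in> D\<close> \<open>scl d x \<in> D\<close>]) auto
    qed
    then show ?thesis
      using that
      by (intro exI[of _ "(\<lambda>c. scl c x) ` {d..1}"] conjI connected_scl_image connected_Icc mem_scl_image imageI)
        auto
  qed
  have "\<exists>K. connected K \<and> K \<subseteq> D \<and> x \<in> K \<and> y \<in> K" if xy: "x \<in> D" "y \<in> D" for x y
  proof (cases "\<exists>d>0. y = scl d x")
    case True
    then obtain d where d: "d > 0" "y = scl d x" by auto
    show ?thesis
    proof (cases "d \<le> 1")
      case True
      then show ?thesis using leg[of x d] xy d by auto
    next
      case False
      then have "x = scl (1/d) y" using d by auto
      then show ?thesis using leg[of y "1/d"] xy d False by auto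
    qed
  next
    case False
    have "\<not> (\<exists>d>0. x = scl d y)"
    proof
      assume "\<exists>d>0. x = scl d y"
      then obtain d where "d > 0" "x = scl d y" by auto
      then have "y = scl (1/d) x" "1/d > 0" by auto
      with False show False by blast
    qed
    with False have in_D: "scl c x \<in> D" "scl c y \<in> D" if "0 \<le> c" "c \<le> 1" for c
      using leg_convex_to_zero[OF assms] xy that by auto
    have "connected ((\<lambda>c. scl c x) ` {0..1} \<union> (\<lambda>c. scl c y) ` {0..1})"
    proof (intro connected_Un connected_scl_image connected_Icc)
      have "scl 0 x \<in> (\<lambda>c. scl c x) ` {0..1} \<inter> (\<lambda>c. scl c y) ` {0..1}"
        by (intro IntI image_eqI[of _ _ 0]) auto
      then show "(\<lambda>c. scl c x) ` {0..1} \<inter> (\<lambda>c. scl c y) ` {0..1} \<noteq> {}"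
        by blast
    qed
    moreover have "(\<lambda>c. scl c x) ` {0..1} \<union> (\<lambda>c. scl c y) ` {0..1} \<subseteq> D"
      using in_D by auto
    moreover have "x \<in> (\<lambda>c. scl c x) ` {0..1}" "y \<in> (\<lambda>c. scl c y) ` {0..1}"
      by (rule mem_scl_image, simp)+
    ultimately show ?thesis
      by blast
  qed
  then have "connected_component D x y" if "x \<in> D" "y \<in> D" for x y
    using that unfolding connected_component_def by simp
  then show ?thesis
    by (simp add: connected_iff_connected_component)
qed

section \<open>Coordinates, membership and compactness of \<open>M\<close>\<close>

locale two_slopes =
  fixes r \<rho> :: real
  assumes r_pos: "0 < r" and r_less_1: "r < 1" and \<rho>_gt_1: "1 < \<rho>"
begin

abbreviation "M \<equiv> M_space r \<rho>"

lemma M_iff: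
  "x \<in> M \<longleftrightarrow> (\<forall>i. 0 \<le> x i \<and> x i \<le> 1 \<and> (x (Suc i) = r * x i \<or> x (Suc i) = \<rho> * x i))"
  by (auto simp: M_space_def L_rel_def)

lemma M_bounds: "x \<in> M \<Longrightarrow> 0 \<le> x i" "x \<in> M \<Longrightarrow> x i \<le> 1"
  by (auto simp: M_iff)

lemma M_step: "x \<in> M \<Longrightarrow> x (Suc i) = r * x i \<or> x (Suc i) = \<rho> * x i"
  by (auto simp: M_iff)

text \<open>A zero coordinate stays zero under either slope, so \<open>x 0 \<noteq> 0\<close> serves
  below as the test for a non-zero point of \<open>M\<close>.\<close>

lemma M_zero_iff: "x \<in> M \<Longrightarrow> x 0 = 0 \<longleftrightarrow> x = (\<lambda>_. 0)"
proof
  assume x: "x \<in> M" "x 0 = 0"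
  have "x i = 0" for i
  proof (induction i)
    case (Suc i)
    then show ?case using M_step[OF x(1), of i] by auto
  qed (use x in auto)
  then show "x = (\<lambda>_. 0)" by auto
qed auto

lemma M_pos:
  assumes "x \<in> M" "x 0 \<noteq> 0"
  shows "x i > 0"
proof (induction i)
  case 0
  then show ?case using assms M_bounds(1)[of x 0] by simp
next
  case (Suc i)
  then show ?case using M_step[OF assms(1), of i] r_pos \<rho>_gt_1 by auto
qed

lemma zero_in_M: "(\<lambda>_. 0) \<in> M"
  by (auto simp: M_iff)

lemma scl_in_M: "x \<in> M \<Longrightarrow> 0 \<le> c \<Longrightarrow> c \<le> 1 \<Longrightarrow> scl c x \<in> M"
  by (auto simp: M_iff mult_le_one)

lemma prepend_in_M:
  assumes "x \<in> M" "s = r \<or> s = \<rho>" "x 0 / s \<le> 1"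
  shows "prepend (x 0 / s) x \<in> M"
  using assms r_pos \<rho>_gt_1 by (auto simp: M_iff prepend_def split: nat.split)

lemma prepend_simps [simp]:
  "prepend a x 0 = a" "prepend a x (Suc i) = x i" "seq_shift (prepend a x) = x"
  by (auto simp: prepend_def seq_shift_def)

text \<open>This concrete point supplies small points near 0, a leg of the triod, two points with
  the same shift, and a target with first coordinate 1.\<close>

lemma geometric_in_M: "(\<lambda>i. r ^ i) \<in> M"
  using r_pos r_less_1 by (auto simp: M_iff power_le_one)

lemma closed_M: "closed M"
proof -
  have "M = (\<Inter>i. {x. 0 \<le> x i} \<inter> {x. x i \<le> 1} \<inter> ({x. x (Suc i) = r * x i} \<union> {x. x (Suc i) = \<rho> * x i}))"
    by (auto simp: M_iff)
  also have "closed \<dots>"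
    by (intro closed_INT closed_Int closed_Un ballI closed_Collect_le closed_Collect_eq continuous_intros)
  finally show ?thesis .
qed

lemma compact_M: "compact M"
proof -
  have "compactin (product_topology (\<lambda>i. euclidean) UNIV) (PiE UNIV (\<lambda>i::nat. {0..1::real}))"
    unfolding compactin_PiE by simp
  then have "compact (PiE UNIV (\<lambda>i::nat. {0..1::real}))"
    by (simp add: euclidean_product_topology)
  moreover have "M \<subseteq> PiE UNIV (\<lambda>i. {0..1})"
    by (auto simp: M_iff)
  ultimately show ?thesis
    using closed_M compact_Int_closed by (metis inf.absorb2)
qed

section \<open>Separation along a leg\<close>

text \<open>If \<open>scl c x\<close> were missing, \<open>C\<close> would split into two closed
  parts containing \<open>x\<close> and \<open>y\<close>. The part of \<open>x\<close> consists of
  the points that start at or above \<open>c * x 0\<close> and follow the slopes of \<open>x\<close>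
  for \<open>N\<close> steps; closedness of \<open>C\<close> makes a finite \<open>N\<close>
  suffice.\<close>

lemma leg_convex_if_connected:
  assumes C: "connected C" "closed C" "C \<subseteq> M"
  shows "leg_convex C"
  unfolding leg_convex_def
proof (intro ballI allI impI, elim conjE)
  fix x y c
  assume x: "x \<in> C" and y: "y \<in> C" and c: "0 < c" "c < 1" and beyond: "\<forall>d>c. y \<noteq> scl d x"
  have xM: "x \<in> M" and yM: "y \<in> M"
    using x y C by auto
  show "scl c x \<in> C"
  proof (cases "x 0 = 0")
    case True
    then have "scl c x = x"
      using M_zero_iff[OF xM] by (auto simp: scl_def)
    then show ?thesis using x by simp
  next
    case False
    have x_pos: "x i > 0" for i
      using M_pos[OF xM False] .
    \<comment> \<open>Equality of the first \<open>n\<close> slopes is written without division,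
      which makes it a closed condition on the coordinates.\<close>
    define agree where "agree n w \<longleftrightarrow> (\<forall>i<n. w (Suc i) * x i = x (Suc i) * w i)" for n and w :: "nat \<Rightarrow> real"
    have agree_mono: "agree m w" if "agree n w" "m \<le> n" for m n w
      using that by (auto simp: agree_def)
    have agree_scl: "w i = w 0 / x 0 * x i" if "agree n w" "i \<le> n" for n w i
      using that(2)
    proof (induction i)
      case (Suc i)
      then have "w (Suc i) * x i = x (Suc i) * w i"
        using that(1) by (auto simp: agree_def)
      also have "w i = w 0 / x 0 * x i"
        using Suc by auto
      finally have "w (Suc i) * x i = (w 0 / x 0 * x (Suc i)) * x i"
        by simp
      then have "x i = 0 \<or> w (Suc i) = w 0 / x 0 * x (Suc i)"
        unfolding mult_cancel_right by blast
      then show ?case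
        using x_pos[of i] by auto
    qed (use False in auto)
    show ?thesis
    proof (rule ccontr)
      assume contra: "scl c x \<notin> C"
      \<comment> \<open>Otherwise points of \<open>C\<close> with first coordinate
        \<open>c * x 0\<close> that follow \<open>x\<close> for more and more steps converge to
        \<open>scl c x\<close>, and \<open>C\<close> is closed.\<close>
      have "\<exists>n. \<forall>w\<in>C. \<not> (w 0 = c * x 0 \<and> agree n w)"
      proof (rule ccontr)
        assume "\<nexists>n. \<forall>w\<in>C. \<not> (w 0 = c * x 0 \<and> agree n w)"
        then have "\<forall>n. \<exists>w. w \<in> C \<and> w 0 = c * x 0 \<and> agree n w"
          by blast
        then obtain w where "\<forall>n. w n \<in> C \<and> w n 0 = c * x 0 \<and> agree n (w n)"
          unfolding choice_iff ..
        then have w: "w n \<in> C" "w n 0 = c * x 0" "agree n (w n)" for n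
          by simp_all
        have "w \<longlonglongrightarrow> scl c x"
        proof (rule tendsto_coordinatewise_then_fun)
          fix i
          have "w n i = c * x i" if "n \<ge> i" for n
            using agree_scl[OF w(3) that] w(2)[of n] False by simp
          then have "\<forall>\<^sub>F n in sequentially. w n i = scl c x i"
            by (auto simp: eventually_sequentially)
          then show "(\<lambda>n. w n i) \<longlonglongrightarrow> scl c x i"
            by (rule tendsto_eventually)
        qed
        then show False
          using closed_sequentially[OF C(2)] w(1) contra by blast
      qed
      then obtain n where n: "\<And>w. w \<in> C \<Longrightarrow> w 0 = c * x 0 \<Longrightarrow> \<not> agree n w"
        by blast
      \<comment> \<open>A point that follows \<open>x\<close> forever is a multiple of
        \<open>x\<close>, and by \<open>beyond\<close> the factor of \<open>y\<close> could not
        exceed \<open>c\<close>.\<close>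
      have "\<exists>m. y 0 \<le> c * x 0 \<or> \<not> agree m y"
      proof (rule ccontr)
        assume "\<nexists>m. y 0 \<le> c * x 0 \<or> \<not> agree m y"
        then have y0: "y 0 > c * x 0" and ag: "\<And>m. agree m y"
          by (auto simp: not_le)
        have "y = scl (y 0 / x 0) x"
          unfolding scl_def by (rule ext) (rule agree_scl[OF ag order_refl])
        moreover have "y 0 / x 0 > c"
          using y0 x_pos[of 0] by (simp add: field_simps)
        ultimately show False
          using beyond by blast
      qed
      then obtain m where m: "y 0 \<le> c * x 0 \<or> \<not> agree m y" ..
      define N where "N = max m n"
      have yN: "y 0 \<le> c * x 0 \<or> \<not> agree N y"
        using m agree_mono[of N y m] by (auto simp: N_def)
      have nN: "\<not> agree N w" if "w \<in> C" "w 0 = c * x 0" for w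
        using n[OF that] agree_mono[of N w n] by (auto simp: N_def)
      define A where "A = {w. c * x 0 \<le> w 0} \<inter> (\<Inter>i\<in>{..<N}. {w. w (Suc i) * x i = x (Suc i) * w i})"
      \<comment> \<open>Where \<open>w\<close> and \<open>x\<close> follow different lines of the relation, their slopes add up to \<open>r + \<rho>\<close>;
        this makes disagreement on the first \<open>N\<close> steps a closed condition.\<close>
      define B where "B = {w. w 0 \<le> c * x 0} \<union>
        (\<Union>i\<in>{..<N}. {w. w (Suc i) * x i + x (Suc i) * w i = (r + \<rho>) * (x i * w i)})"
      have disagree: "w (Suc i) * x i + x (Suc i) * w i = (r + \<rho>) * (x i * w i)"
        if "w \<in> M" "w (Suc i) * x i \<noteq> x (Suc i) * w i" for w i
        using M_step[OF that(1), of i] M_step[OF xM, of i] that(2) by (auto simp: algebra_simps)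
      have "closed A"
        unfolding A_def
        by (intro closed_Int closed_INT ballI closed_Collect_le closed_Collect_eq continuous_intros)
      moreover have "closed B"
        unfolding B_def
        by (intro closed_Un closed_UN finite_lessThan ballI closed_Collect_le closed_Collect_eq continuous_intros)
      moreover have "C \<subseteq> A \<union> B"
      proof
        fix w assume w: "w \<in> C"
        show "w \<in> A \<union> B"
        proof (cases "agree N w")
          case True
          then show ?thesis by (auto simp: A_def B_def agree_def)
        next
          case False
          then obtain i where "i < N" "w (Suc i) * x i \<noteq> x (Suc i) * w i"
            by (auto simp: agree_def)
          then have "w \<in> B"
            using disagree[of w i] w C(3) by (auto simp: B_def)
          then show ?thesis ..
        qed
      qed
      \<comment> \<open>The choice of \<open>N\<close> excludes the first coordinate
        \<open>c * x 0\<close>. So at some index the slopes of \<open>w\<close> and \<open>x\<close>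
        would both be equal and add up to \<open>r + \<rho>\<close>, but the mean of
        \<open>r\<close> and \<open>\<rho>\<close> is neither of them.\<close>
      moreover have "A \<inter> B \<inter> C = {}"
      proof -
        have False if w: "w \<in> A" "w \<in> B" "w \<in> C" for w
        proof -
          have agr: "agree N w" and w0: "c * x 0 \<le> w 0"
            using w(1) by (auto simp: A_def agree_def)
          have wM: "w \<in> M" using w C by auto
          have "w 0 \<noteq> 0"
            using w0 c x_pos[of 0] by (smt (verit) mult_pos_pos)
          note w_pos = M_pos[OF wM this]
          have "w 0 \<noteq> c * x 0"
            using nN[OF w(3)] agr by blast
          then obtain i where i: "i < N" "w (Suc i) * x i + x (Suc i) * w i = (r + \<rho>) * (x i * w i)"
            using w(2) w0 by (auto simp: B_def)
          have "w (Suc i) * x i = x (Suc i) * w i"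
            using agr i by (auto simp: agree_def)
          with i have *: "2 * (x (Suc i) * w i) = (r + \<rho>) * (x i * w i)"
            by simp
          have "x i * w i > 0"
            using x_pos[of i] w_pos[of i] by simp
          moreover have "2 * s * (x i * w i) = (r + \<rho>) * (x i * w i)" if "x (Suc i) = s * x i" for s
            using * that by (simp add: mult_ac)
          ultimately have "2 * s = r + \<rho>" if "x (Suc i) = s * x i" for s
            using that by (metis less_irrefl mult_right_cancel)
          then have "2 * r = r + \<rho> \<or> 2 * \<rho> = r + \<rho>"
            using M_step[OF xM, of i] by blast
          then show False
            using r_less_1 \<rho>_gt_1 by auto
        qed
        then show ?thesis by blast
      qed
      moreover have "x \<in> A"
        using c x_pos[of 0] by (auto simp: A_def)
      moreover have "y \<in> B"
        using yN disagree[OF yM] by (auto simp: B_def agree_def)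
      ultimately show False
        using connected_closedD[OF C(1), of A B] x y by blast
    qed
  qed
qed

section \<open>Arcs in \<open>M\<close> and the dendroid property\<close>

lemma leg_Int:
  assumes "x \<in> M" "y \<in> M" "\<And>d. 0 < d \<Longrightarrow> y \<noteq> scl d x"
  shows "(\<lambda>c. scl c x) ` {0..1} \<inter> (\<lambda>c. scl c y) ` {0..1} = {\<lambda>_. 0}"
proof -
  have "scl c x = (\<lambda>_. 0)" if c: "0 \<le> c" "0 \<le> d" "scl c x = scl d y" for c d
  proof (cases "c = 0 \<or> d = 0")
    case True
    then show ?thesis using c(3) by auto
  next
    case False
    then have "scl (1/d) (scl c x) = y"
      using c(3) by simp
    then have "y = scl (c / d) x"
      by simp
    then show ?thesis using assms(3)[of "c / d"] False c by auto
  qed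
  moreover have "(\<lambda>_. 0) \<in> (\<lambda>c. scl c z) ` {0..1}" for z
    by (rule image_eqI[of _ _ 0]) auto
  ultimately show ?thesis
    by fastforce
qed

text \<open>On one leg the segment serves; otherwise two legs are joined at 0, their only common
  point by \<open>leg_Int\<close>, so the join is an arc.\<close>

lemma arc_between:
  assumes "x \<in> M" "y \<in> M" "x \<noteq> y"
  shows "\<exists>g. arc g \<and> path_image g \<subseteq> M \<and> pathstart g = x \<and> pathfinish g = y"
proof -
  \<comment> \<open>For \<open>d > 1\<close> the segment rises above \<open>z\<close>; its points
    are then contractions of \<open>scl d z\<close>, which lies in \<open>M\<close>.\<close>
  have seg: "scl c z \<in> M" if "z \<in> M" "scl d z \<in> M" "z 0 \<noteq> 0" "c \<in> closed_segment 1 d" for c d z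
  proof -
    have "d \<ge> 0"
      using M_bounds(1)[OF that(2), of 0] M_pos[OF that(1,3), of 0]
      by (simp add: zero_le_mult_iff)
    show ?thesis
    proof (cases "d \<le> 1")
      case True
      then show ?thesis
        using that \<open>d \<ge> 0\<close> by (intro scl_in_M) (auto simp: closed_segment_eq_real_ivl split: if_splits)
    next
      case False
      then have "scl (c / d) (scl d z) \<in> M"
        using that by (intro scl_in_M[OF that(2)]) (auto simp: closed_segment_eq_real_ivl)
      then show ?thesis using False by simp
    qed
  qed
  have leg: "\<exists>g. arc g \<and> path_image g = (\<lambda>c. scl c z) ` closed_segment 1 d \<and> path_image g \<subseteq> M \<and>
      pathstart g = z \<and> pathfinish g = scl d z"
    if "z \<in> M" "scl d z \<in> M" "z \<noteq> scl d z" for z d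
  proof -
    have "z 0 \<noteq> 0"
    proof
      assume "z 0 = 0"
      then have "z = (\<lambda>_. 0)"
        using M_zero_iff[OF that(1)] by simp
      then show False
        using that(3) by (simp add: scl_def)
    qed
    moreover have "1 \<noteq> d"
      using that(3) by auto
    moreover have "(\<lambda>c. scl c z) ` closed_segment 1 d \<subseteq> M"
      using seg[OF that(1,2)] calculation(1) by blast
    ultimately show ?thesis
      by (intro exI[of _ "\<lambda>t. scl (linepath 1 d t) z"] conjI arc_scl)
        (simp_all add: path_image_scl path_ends_scl)
  qed
  show ?thesis
  \<comment> \<open>The factor 0 is allowed, so this case includes the target 0; the start 0 is
    treated below by reversing an arc.\<close>
  proof (cases "\<exists>d\<ge>0. y = scl d x")
    case True
    then obtain d where d: "y = scl d x" by blast
    obtain g where "arc g" "path_image g \<subseteq> M" "pathstart g = x" "pathfinish g = y"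
      using leg[of x d, folded d, OF assms] by blast
    then show ?thesis by blast
  next
    case False
    show ?thesis
    proof (cases "x 0 = 0")
      case True
      then have x: "x = scl 0 y"
        using M_zero_iff[OF assms(1)] by simp
      obtain g where "arc g" "path_image g \<subseteq> M" "pathstart g = y" "pathfinish g = x"
        using leg[of y 0, folded x, OF assms(2,1) assms(3)[symmetric]] by blast
      then show ?thesis
        by (intro exI[of _ "reversepath g"] conjI arc_reversepath) simp_all
    next
      case x0: False
      have y0: "y 0 \<noteq> 0"
      proof
        assume "y 0 = 0"
        then have "y = scl 0 x"
          using M_zero_iff[OF assms(2)] by simp
        then show False
          using False by blast
      qed
      have nz: "z \<noteq> scl 0 z" if "z 0 \<noteq> 0" for z
        using fun_cong[of z "scl 0 z" 0] that by auto
      have zero: "scl 0 z \<in> M" for z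
        using zero_in_M by simp
      have unit: "closed_segment 1 0 = {0..1::real}"
        by (simp add: closed_segment_eq_real_ivl)
      obtain g where g: "arc g" "path_image g = (\<lambda>c. scl c x) ` {0..1}" "path_image g \<subseteq> M"
        "pathstart g = x" "pathfinish g = (\<lambda>_. 0)"
        using leg[OF assms(1) zero nz[of x, OF x0]] unfolding unit scl_0 by blast
      obtain h where h: "arc h" "path_image h = (\<lambda>c. scl c y) ` {0..1}" "path_image h \<subseteq> M"
        "pathstart h = y" "pathfinish h = (\<lambda>_. 0)"
        using leg[OF assms(2) zero nz[of y, OF y0]] unfolding unit scl_0 by blast
      have "path_image g \<inter> path_image h = {\<lambda>_. 0}"
        unfolding g(2) h(2) by (rule leg_Int[OF assms(1,2)]) (use False in auto)
      then have "arc (g +++ reversepath h)"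
        using g h by (intro arc_join arc_reversepath) simp_all
      moreover have "path_image (g +++ reversepath h) \<subseteq> M"
        using g h by (simp add: path_image_join)
      ultimately show ?thesis
        using g h by (intro exI[of _ "g +++ reversepath h"] conjI) simp_all
    qed
  qed
qed

text \<open>For unicoherence, both closed connected parts of \<open>K\<close> are leg-convex,
  leg-convexity passes to their intersection, and a closed leg-convex set is connected.\<close>

lemma dendroid_M: "dendroid M"
  unfolding dendroid_def
proof (intro conjI)
  show "arcwise_connected M"
    unfolding arcwise_connected_def using arc_between by blast
  have "leg_convex M"
    unfolding leg_convex_def using scl_in_M by auto
  then have "connected M"
    using connected_if_leg_convex closed_M by blast
  then show "continuum M"
    using zero_in_M compact_M by (auto simp: continuum_def)
  show "hereditarily_unicoherent M"
    unfolding hereditarily_unicoherent_def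
  proof (intro allI impI, elim conjE)
    fix K assume K: "K \<subseteq> M" "continuum K"
    then have "closed K"
      by (auto simp: continuum_def compact_imp_closed)
    show "unicoherent K"
    proof
      fix S T assume ST: "connected S" "connected T" "K = S \<union> T"
        "closedin (top_of_set K) S" "closedin (top_of_set K) T"
      then have "closed S" "closed T"
        using \<open>closed K\<close> closedin_closed_trans by blast+
      moreover have "leg_convex (S \<inter> T)"
        using ST K calculation by (intro leg_convex_Int leg_convex_if_connected) auto
      ultimately show "connected (S \<inter> T)"
        by (intro connected_if_leg_convex) auto
    qed
  qed
qed

section \<open>Local shape of arcs: end-points and ramification\<close>

text \<open>Provides the bound that \<open>leg_convexD\<close> asks for: the factor of
  \<open>a\<close> if \<open>a\<close> lies below \<open>x\<close> on its leg, and 1/2 if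
  \<open>a\<close> is no positive multiple of \<open>x\<close>.\<close>

lemma near_leg_point:
  assumes "x 0 \<noteq> 0" "a \<noteq> x" "\<And>d. d > 1 \<Longrightarrow> a \<noteq> scl d x"
  shows "\<exists>c. 0 < c \<and> c < 1 \<and> (\<forall>d>c. a \<noteq> scl d x)"
proof (cases "\<exists>d>0. a = scl d x")
  case True
  then obtain d where d: "d > 0" "a = scl d x" by auto
  then have "d < 1"
    using assms by (cases d "1::real" rule: linorder_cases) auto
  then show ?thesis
    using d scl_eq_iff[of x, OF assms(1)] by (intro exI[of _ d]) auto
next
  case False
  then show ?thesis by (intro exI[of _ "1/2"]) auto
qed

text \<open>If \<open>x\<close> were an inner point of an arc, each half would join \<open>x\<close>
  to a point not above it on its leg. By leg-convexity both halves would contain a common point of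
  the leg below \<open>x\<close>, but they share only \<open>x\<close>.\<close>

lemma end_pointI:
  assumes "x \<in> M" "x 0 \<noteq> 0" "\<And>d. d > 1 \<Longrightarrow> scl d x \<notin> M"
  shows "x \<in> end_points M"
  unfolding end_points_def
proof (intro CollectI conjI allI impI, fact, elim conjE, rule ccontr)
  fix g assume g: "arc g" "path_image g \<subseteq> M" "x \<in> path_image g"
    "\<not> (x = pathstart g \<or> x = pathfinish g)"
  then obtain t where t: "t \<in> {0..1}" "x = g t"
    by (auto simp: path_image_def)
  note split = arc_split[OF g(1) t(1)]
  have lc: "leg_convex (g ` {0..t})" "leg_convex (g ` {t..1})"
    by (intro leg_convex_if_connected split order_trans[OF split(5) g(2)] order_trans[OF split(6) g(2)])+
  have ends: "\<exists>c. 0 < c \<and> c < 1 \<and> (\<forall>d>c. g s \<noteq> scl d x)" if "s = 0 \<or> s = 1" for s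
  proof (rule near_leg_point[of x, OF assms(2)])
    show "g s \<noteq> x"
      using that g(4) by (auto simp: pathstart_def pathfinish_def)
    have "g s \<in> M"
      using that g(2) by (auto simp: path_image_def)
    then show "g s \<noteq> scl d x" if "d > 1" for d
      using assms(3)[OF that] by auto
  qed
  obtain a where a: "0 < a" "a < 1" "\<forall>d>a. g 0 \<noteq> scl d x"
    using ends[of 0] by auto
  obtain b where b: "0 < b" "b < 1" "\<forall>d>b. g 1 \<noteq> scl d x"
    using ends[of 1] by auto
  have "scl (max a b) x \<in> g ` {0..t}"
    by (rule leg_convexD[OF lc(1), of _ "g 0"]) (use a b t in auto)
  moreover have "scl (max a b) x \<in> g ` {t..1}"
    by (rule leg_convexD[OF lc(2), of _ "g 1"]) (use a b t in auto)
  ultimately have "scl (max a b) x = x"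
    using split(7) t(2) by blast
  then show False
    using a b assms(2) by simp
qed

text \<open>Leg-convexity is applied to the two ends of the arc, with their roles exchanged if the
  other end lies above \<open>x\<close> on its leg. Hence arcs can leave a non-zero point in two
  directions only.\<close>

lemma arc_germ:
  assumes "arc g" "path_image g \<subseteq> M" "pathstart g = x" "x 0 \<noteq> 0"
  shows "(\<exists>a<1. \<forall>c. a < c \<and> c < 1 \<longrightarrow> scl c x \<in> path_image g) \<or>
    (\<exists>b>1. \<forall>c. 1 < c \<and> c < b \<longrightarrow> scl c x \<in> path_image g)"
proof -
  have lc: "leg_convex (path_image g)"
    using assms(1,2) by (intro leg_convex_if_connected) (auto simp: arc_imp_path compact_imp_closed compact_path_image connected_path_image)
  define y where "y = pathfinish g"
  have x: "x \<in> path_image g" and y: "y \<in> path_image g"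
    using assms(3) by (auto simp: y_def)
  have "y \<noteq> x"
    using arc_distinct_ends[OF assms(1)] assms(3) by (simp add: y_def)
  show ?thesis
  proof (cases "\<exists>b>1. y = scl b x")
    case True
    then obtain b where b: "b > 1" "y = scl b x" by auto
    have "scl c x \<in> path_image g" if "1 < c" "c < b" for c
    proof -
      \<comment> \<open>This is \<open>scl c x\<close> seen from the upper end \<open>y\<close>; its
        factor \<open>c / b\<close> exceeds the factor \<open>1 / b\<close> of
        \<open>x\<close>.\<close>
      have "scl (c / b) y \<in> path_image g"
      proof (rule leg_convexD[OF lc y x])
        show "x \<noteq> scl d y" if "c / b < d" for d
        proof -
          have "d * b \<noteq> 1"
            using that \<open>1 < c\<close> b by (auto simp: field_simps)
          then show ?thesis
            using b assms(4) by simp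
        qed
      qed (use that b in auto)
      then show ?thesis
        using b by simp
    qed
    with b show ?thesis by blast
  next
    case False
    then obtain a where a: "0 < a" "a < 1" "\<forall>d>a. y \<noteq> scl d x"
      using near_leg_point[of x, OF assms(4) \<open>y \<noteq> x\<close>] by blast
    have "scl c x \<in> path_image g" if "a < c" "c < 1" for c
      by (rule leg_convexD[OF lc x y]) (use that a in auto)
    with a show ?thesis by blast
  qed
qed

text \<open>At a non-zero point three arcs would have only two directions to share; at 0 three legs
  with different slopes form a triod.\<close>

lemma ramification_points_M: "ramification_points M = {\<lambda>_. 0}"
proof (intro equalityI subsetI)
  fix x assume "x \<in> ramification_points M"
  then obtain g1 g2 g3 where x: "x \<in> M"
    and g: "\<forall>g\<in>{g1, g2, g3}. arc g \<and> path_image g \<subseteq> M \<and> pathstart g = x"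
    and Int: "path_image g1 \<inter> path_image g2 = {x}" "path_image g1 \<inter> path_image g3 = {x}"
      "path_image g2 \<inter> path_image g3 = {x}"
    by (auto simp: ramification_points_def)
  have "x 0 = 0"
  proof (rule ccontr)
    assume x0: "x 0 \<noteq> 0"
    define down where "down g \<longleftrightarrow> (\<exists>a<1. \<forall>c. a < c \<and> c < 1 \<longrightarrow> scl c x \<in> path_image g)" for g
    define up where "up g \<longleftrightarrow> (\<exists>b>1. \<forall>c. 1 < c \<and> c < b \<longrightarrow> scl c x \<in> path_image g)" for g
    have germ: "down g \<or> up g" if "g \<in> {g1, g2, g3}" for g
      using arc_germ[of g x] g that x0 unfolding down_def up_def by blast
    have not_down: "\<not> (down g \<and> down h)" if "path_image g \<inter> path_image h = {x}" for g h
    proof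
      assume "down g \<and> down h"
      then obtain a b where ab: "a < 1" "b < 1" "\<And>c. a < c \<Longrightarrow> c < 1 \<Longrightarrow> scl c x \<in> path_image g"
        "\<And>c. b < c \<Longrightarrow> c < 1 \<Longrightarrow> scl c x \<in> path_image h"
        unfolding down_def by blast
      obtain c where c: "max a b < c" "c < 1"
        using dense[of "max a b" 1] ab by auto
      then have "scl c x \<in> path_image g \<inter> path_image h"
        using ab by auto
      then have "scl c x = x"
        unfolding that by simp
      then show False
        using c x0 by simp
    qed
    have not_up: "\<not> (up g \<and> up h)" if "path_image g \<inter> path_image h = {x}" for g h
    proof
      assume "up g \<and> up h"
      then obtain a b where ab: "a > 1" "b > 1" "\<And>c. 1 < c \<Longrightarrow> c < a \<Longrightarrow> scl c x \<in> path_image g"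
        "\<And>c. 1 < c \<Longrightarrow> c < b \<Longrightarrow> scl c x \<in> path_image h"
        unfolding up_def by blast
      obtain c where c: "1 < c" "c < min a b"
        using dense[of 1 "min a b"] ab by auto
      then have "scl c x \<in> path_image g \<inter> path_image h"
        using ab by auto
      then have "scl c x = x"
        unfolding that by simp
      then show False
        using c x0 by simp
    qed
    \<comment> \<open>By the pigeonhole principle two of the three arcs leave in the same
      direction.\<close>
    show False
      using germ[of g1] germ[of g2] germ[of g3] not_down[OF Int(1)] not_down[OF Int(2)] not_down[OF Int(3)]
        not_up[OF Int(1)] not_up[OF Int(2)] not_up[OF Int(3)] by simp blast
  qed
  then show "x \<in> {\<lambda>_. 0}"
    using M_zero_iff[OF x] by simp
next
  fix v :: "nat \<Rightarrow> real" assume "v \<in> {\<lambda>_. 0}"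
  then have v: "v = (\<lambda>_. 0)" by simp
  \<comment> \<open>The slopes of \<open>p0\<close> are all \<open>r\<close>; \<open>p1\<close> and
    \<open>p2\<close> first climb by \<open>\<rho>\<close> once and twice. Any two of them differ in
    a slope at index 0 or 1.\<close>
  define p0 where "p0 = (\<lambda>i. r ^ i)"
  define p1 where "p1 = prepend (p0 0 / \<rho>) p0"
  define p2 where "p2 = prepend (p1 0 / \<rho>) p1"
  have p0M: "p0 \<in> M"
    using geometric_in_M by (simp add: p0_def)
  have p1M: "p1 \<in> M"
    unfolding p1_def by (rule prepend_in_M[OF p0M]) (use \<rho>_gt_1 in \<open>auto simp: p0_def\<close>)
  have p2M: "p2 \<in> M"
    unfolding p2_def by (rule prepend_in_M[OF p1M])
      (use \<rho>_gt_1 in \<open>auto simp: p0_def p1_def field_simps intro: less_imp_le less_1_mult\<close>)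
  define leg where "leg p = (\<lambda>t. scl (linepath 0 1 t) p)" for p
  have leg: "arc (leg p) \<and> path_image (leg p) \<subseteq> M \<and> pathstart (leg p) = v" if "p \<in> M" "p 0 \<noteq> 0" for p
    using that unfolding leg_def v path_image_scl path_ends_scl
    by (intro conjI arc_scl) (auto simp: closed_segment_eq_real_ivl intro: scl_in_M)
  have leg_image: "path_image (leg p) = (\<lambda>c. scl c p) ` {0..1}" for p
    using path_image_scl[of 0 1 p] by (simp add: leg_def closed_segment_eq_real_ivl)
  have val: "p0 0 = 1" "p0 (Suc 0) = r" "p1 0 = 1 / \<rho>" "p1 (Suc 0) = 1" "p1 (Suc (Suc 0)) = r"
    "p2 0 = 1 / \<rho> / \<rho>" "p2 (Suc 0) = 1 / \<rho>" "p2 (Suc (Suc 0)) = 1"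
    by (simp_all add: p0_def p1_def p2_def)
  have slope: "p \<noteq> scl d q" if "p (Suc i) = \<rho> * p i" "q (Suc i) = r * q i" "p i \<noteq> 0" for p q d i
  proof
    assume eq: "p = scl d q"
    have "r * p i = p (Suc i)"
      using that(2) unfolding eq by simp
    then show False
      using that(1,3) r_less_1 \<rho>_gt_1 by simp
  qed
  have distinct: "p1 \<noteq> scl d p0" "p2 \<noteq> scl d p0" "p2 \<noteq> scl d p1" for d
    using slope[of p1 0 p0 d] slope[of p2 0 p0 d] slope[of p2 "Suc 0" p1 d] \<rho>_gt_1
    by (simp_all add: val)
  have "path_image (leg p0) \<inter> path_image (leg p1) = {v}"
    "path_image (leg p0) \<inter> path_image (leg p2) = {v}"
    "path_image (leg p1) \<inter> path_image (leg p2) = {v}"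
    unfolding leg_image v by (intro leg_Int p0M p1M p2M distinct; assumption)+
  moreover have "\<forall>g\<in>{leg p0, leg p1, leg p2}. arc g \<and> path_image g \<subseteq> M \<and> pathstart g = v"
    using leg p0M p1M p2M val \<rho>_gt_1 by auto
  ultimately show "v \<in> ramification_points M"
    unfolding ramification_points_def using zero_in_M v by blast
qed

section \<open>Unique arcs from 0 and smoothness\<close>

text \<open>The arc contains the leg by leg-convexity. Conversely, cut it at \<open>w\<close>: if
  \<open>w\<close> lies above \<open>x\<close>, the piece from 0 to \<open>w\<close> contains
  \<open>x\<close>; if \<open>x\<close> is no positive multiple of \<open>w\<close>, the piece from
  \<open>w\<close> to \<open>x\<close> contains 0. The pieces meet only in \<open>w\<close>, so
  \<open>w = x\<close> or \<open>w = 0\<close>.\<close>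

lemma arc_from_zero:
  assumes "is_arc_from_to M (\<lambda>_. 0) x A" "x \<in> M"
  shows "A = (\<lambda>c. scl c x) ` {0..1}"
proof (cases "x = (\<lambda>_. 0)")
  case True
  have "(\<lambda>c. scl c x) ` {0..1} = (\<lambda>_. \<lambda>_. 0) ` {0..1::real}"
    by (intro image_cong refl) (simp add: True scl_def)
  also have "\<dots> = {\<lambda>_. 0}"
    by (rule image_constant[of 0]) simp
  finally show ?thesis
    using assms True by (simp add: is_arc_from_to_def)
next
  case False
  then obtain g where g: "arc g" "path_image g = A" "pathstart g = (\<lambda>_. 0)" "pathfinish g = x" "A \<subseteq> M"
    using assms by (auto simp: is_arc_from_to_def)
  have x0: "x 0 \<noteq> 0"
    using False M_zero_iff[OF assms(2)] by simp
  have g01: "g 0 = (\<lambda>_. 0)" "g 1 = x"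
    using g(3,4) by (auto simp: pathstart_def pathfinish_def)
  have conv: "leg_convex (g ` {0..t}) \<and> leg_convex (g ` {t..1}) \<and> closed (g ` {0..t}) \<and> closed (g ` {t..1})
      \<and> g ` {0..t} \<inter> g ` {t..1} = {g t}"
    if "t \<in> {0..1}" for t
  proof -
    note split = arc_split[OF g(1) that, unfolded g(2)]
    show ?thesis
      by (intro conjI leg_convex_if_connected split order_trans[OF split(5) g(5)] order_trans[OF split(6) g(5)])
  qed
  have not_zero: "(\<lambda>_. 0) \<noteq> scl d w" if "d > 0" "w 0 \<noteq> 0" for d w
    using that by (auto simp: fun_eq_iff intro!: exI[of _ 0])
  show ?thesis
  proof (intro equalityI subsetI)
    fix w assume "w \<in> (\<lambda>c. scl c x) ` {0..1}"
    then obtain c where c: "0 \<le> c" "c \<le> 1" "w = scl c x" by auto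
    have "g 0 \<in> g ` {0..1}" "g 1 \<in> g ` {0..1}"
      by simp_all
    then have "scl c x \<in> g ` {0..1}"
      using conv[of 1] c g01 not_zero[of _ x, OF _ x0] by (intro leg_convex_to_zero[of _ x "\<lambda>_. 0"]) auto
    then show "w \<in> A"
      using c g(2) by (simp add: path_image_def)
  next
    fix w assume w: "w \<in> A"
    then obtain t where t: "t \<in> {0..1}" "w = g t"
      using g(2) by (auto simp: path_image_def)
    note C = conv[OF t(1)]
    have unique: "v = w" if "v \<in> g ` {0..t}" "v \<in> g ` {t..1}" for v
      using that C t(2) by blast
    have mem: "(\<lambda>_. 0) \<in> g ` {0..t}" "w \<in> g ` {0..t}" "w \<in> g ` {t..1}" "x \<in> g ` {t..1}"
      using t imageI[of 0 "{0..t}" g] imageI[of 1 "{t..1}" g] unfolding g01 by auto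
    have wM: "w \<in> M"
      using w g by auto
    show "w \<in> (\<lambda>c. scl c x) ` {0..1}"
    proof (cases "\<exists>d>0. x = scl d w")
      case True
      then obtain d where d: "d > 0" "x = scl d w" by auto
      show ?thesis
      proof (cases "d \<ge> 1")
        case True
        then show ?thesis
          using d by (intro image_eqI[of _ _ "1 / d"]) auto
      next
        case False
        have d1: "0 \<le> d" "d \<le> 1" using False d(1) by simp_all
        have w0: "w 0 \<noteq> 0" using d x0 by auto
        have "scl d w \<in> g ` {0..t}"
        proof (rule leg_convex_to_zero)
          show "leg_convex (g ` {0..t})" "closed (g ` {0..t})"
            using C by blast+
          show "(\<lambda>_. 0) \<noteq> scl e w" if "e > 0" for e
            using that w0 by (rule not_zero)
        qed (rule mem d1)+
        then have "x \<in> g ` {0..t}"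
          by (simp only: d)
        then have "x = w"
          using mem(4) by (rule unique)
        then show ?thesis
          by (simp add: mem_scl_image)
      qed
    next
      case False
      have "scl 0 w \<in> g ` {t..1}"
      proof (rule leg_convex_to_zero)
        show "leg_convex (g ` {t..1})" "closed (g ` {t..1})"
          using C by blast+
        show "x \<noteq> scl e w" if "e > 0" for e
          using that False by blast
      qed (rule mem order_refl zero_le_one)+
      then have "(\<lambda>_. 0) \<in> g ` {t..1}"
        by (simp only: scl_0)
      with mem(1) have "(\<lambda>_. 0) = w"
        by (rule unique)
      then have "w = scl 0 x"
        by simp
      then show ?thesis
        by (rule image_eqI) simp
    qed
  qed
qed

text \<open>The arcs are legs, and points with equal factors on two legs are at most
  \<open>dist (xs n) x\<close> apart, which settles both halves of the Hausdorff condition.\<close>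

lemma smooth_M: "smooth_at M (\<lambda>_. 0)"
  unfolding smooth_at_def
proof (intro allI impI, elim conjE)
  fix xs x A B
  assume M: "\<forall>n. xs n \<in> M" "x \<in> M" and lim: "xs \<longlonglongrightarrow> x"
    and arcs: "\<forall>n::nat. is_arc_from_to M (\<lambda>_. 0) (xs n) (A n)" "is_arc_from_to M (\<lambda>_. 0) x B"
  have A: "A n = (\<lambda>c. scl c (xs n)) ` {0..1}" for n
    using arcs M by (intro arc_from_zero) auto
  have B: "B = (\<lambda>c. scl c x) ` {0..1}"
    using arcs M by (intro arc_from_zero) auto
  show "hausdorff_tendsto A B"
    unfolding hausdorff_tendsto_def
  proof (intro allI impI)
    fix e :: real assume "e > 0"
    then have "\<forall>\<^sub>F n in sequentially. dist (xs n) x < e"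
      using lim by (simp add: tendstoD)
    then show "\<forall>\<^sub>F n in sequentially.
        (\<forall>a\<in>A n. \<exists>b\<in>B. dist a b < e) \<and> (\<forall>b\<in>B. \<exists>a\<in>A n. dist a b < e)"
    proof eventually_elim
      case (elim n)
      then have "dist (scl c (xs n)) (scl c x) < e" if "c \<in> {0..1}" for c
        using dist_scl_le[of c "xs n" x] that by auto
      then show ?case
        unfolding A B by blast
    qed
  qed
qed

section \<open>Points with prescribed beginning and tail\<close>

lemma glue_in_M:
  assumes "x \<in> M" "w \<in> M" "x N = w 0"
  shows "(\<lambda>i. if i \<le> N then x i else w (i - N)) \<in> M"
proof -
  have "w (Suc (i - N)) = r * w (i - N) \<or> w (Suc (i - N)) = \<rho> * w (i - N)" for i
    using M_step[OF assms(2)] .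
  moreover have "w (Suc 0) = r * x N \<or> w (Suc 0) = \<rho> * x N"
    using M_step[OF assms(2), of 0] assms(3) by simp
  moreover have "Suc i - N = Suc (i - N)" if "i \<ge> N" for i
    using that by (rule Suc_diff_le)
  ultimately have "(if Suc i \<le> N then x (Suc i) else w (Suc i - N)) = r * (if i \<le> N then x i else w (i - N)) \<or>
      (if Suc i \<le> N then x (Suc i) else w (Suc i - N)) = \<rho> * (if i \<le> N then x i else w (i - N))" for i
    using M_step[OF assms(1), of i] by (cases "i < N"; cases "i = N") auto
  then show ?thesis
    unfolding M_iff using M_bounds[OF assms(1)] M_bounds[OF assms(2)] by simp
qed

lemma extend_left:
  assumes "w \<in> M" "s = r \<or> s = \<rho>" "w 0 / s ^ k \<le> 1"
  shows "\<exists>v\<in>M. v 0 = w 0 / s ^ k \<and> (\<forall>i. v (i + k) = w i)"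
  using assms(3)
proof (induction k)
  case 0
  then show ?case using assms by auto
next
  case (Suc k)
  \<comment> \<open>Dividing by \<open>r\<close> enlarges the quotients, so the bound on the last
    one covers the earlier ones; dividing by \<open>\<rho>\<close> never leaves [0,1].\<close>
  have "w 0 / s ^ k \<le> 1"
  proof (cases "s = r")
    case True
    have "w 0 / r ^ k = r * (w 0 / r ^ Suc k)"
      using r_pos by simp
    also have "\<dots> \<le> 1"
      using Suc.prems True r_pos r_less_1 M_bounds(1)[OF assms(1), of 0]
      by (intro mult_le_one) auto
    finally show ?thesis using True by simp
  next
    case False
    then have "s \<ge> 1"
      using assms(2) \<rho>_gt_1 by auto
    then have "w 0 \<le> s ^ k"
      using M_bounds(2)[OF assms(1), of 0] one_le_power[of s k] by linarith
    then show ?thesis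
      using \<open>s \<ge> 1\<close> by (simp add: divide_le_eq)
  qed
  then obtain v where v: "v \<in> M" "v 0 = w 0 / s ^ k" "\<forall>i. v (i + k) = w i"
    using Suc.IH by blast
  have "prepend (v 0 / s) v \<in> M"
    using Suc.prems v(2) by (intro prepend_in_M v(1) assms(2)) (simp add: mult.commute)
  then show ?case
    using v by (intro bexI[of _ "prepend (v 0 / s) v"]) (simp_all add: mult.commute)
qed

text \<open>After index \<open>N\<close> the point descends \<open>k\<close> times by
  \<open>r\<close>, climbs \<open>l\<close> times by \<open>\<rho>\<close>, then follows
  \<open>scl t z\<close>. In this order no coordinate exceeds 1: the descent stays at or below
  \<open>x N\<close>, the climb at or below \<open>t * z 0\<close>. The path is built backwards from
  \<open>scl t z\<close>.\<close>

lemma connect: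
  assumes x: "x \<in> M" and z: "z \<in> M" and t: "0 \<le> t" "t \<le> 1"
    and eq: "x N * r ^ k * \<rho> ^ l = t * z 0"
  shows "\<exists>y\<in>M. (\<forall>i\<le>N. y i = x i) \<and> (\<forall>i. y (i + (N + k + l)) = t * z i)"
proof -
  have "t * z 0 / \<rho> ^ l \<le> 1"
    using M_bounds(2)[OF scl_in_M[OF z t], of 0] one_le_power[of \<rho> l] \<rho>_gt_1
    by (simp add: divide_le_eq order_trans[of _ 1])
  then obtain v where v: "v \<in> M" "v 0 = t * z 0 / \<rho> ^ l" "\<And>i. v (i + l) = t * z i"
    using extend_left[OF scl_in_M[OF z t], of \<rho> l] by auto
  have xN: "x N = v 0 / r ^ k"
  proof -
    have "v 0 = x N * r ^ k"
      using \<rho>_gt_1 unfolding v(2) eq[symmetric] by simp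
    then show ?thesis
      using r_pos by simp
  qed
  then obtain w where w: "w \<in> M" "w 0 = x N" "\<And>i. w (i + k) = v i"
    using extend_left[OF v(1), of r k] M_bounds(2)[OF x, of N] by auto
  have after: "(if i + (N + k + l) \<le> N then x (i + (N + k + l)) else w (i + (N + k + l) - N)) = t * z i" for i
  proof -
    have "w (i + (N + k + l) - N) = t * z i"
      using w(3)[of "i + l"] v(3)[of i] by (simp add: ac_simps)
    \<comment> \<open>Only \<open>i = k = l = 0\<close> reaches this branch, at the shared index
      \<open>N\<close>, where \<open>x N = w 0\<close>.\<close>
    moreover have "x (i + (N + k + l)) = w (i + (N + k + l) - N)" if "i + (N + k + l) \<le> N"
    proof -
      have "i = 0" "k = 0" "l = 0" using that by auto
      then show ?thesis using w(2) by simp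
    qed
    ultimately show ?thesis by (simp only: if_cancel split: if_split) blast
  qed
  show ?thesis
    using glue_in_M[OF x w(1), of N] w(2) after
    by (intro bexI[of _ "\<lambda>i. if i \<le> N then x i else w (i - N)"]) simp_all
qed

text \<open>If \<open>U\<close> contains 0, it also contains a small multiple of
  \<open>\<lambda>i. r ^ i\<close>. This reduces questions on open sets to the non-zero points that
  \<open>approach\<close> handles.\<close>

lemma nonzero_in_open:
  assumes "openin (top_of_set M) U" "U \<noteq> {}"
  shows "\<exists>x\<in>U. x 0 \<noteq> 0"
proof -
  obtain x where x: "x \<in> U" using assms by auto
  then have xM: "x \<in> M" using openin_imp_subset[OF assms(1)] by auto
  show ?thesis
  proof (cases "x 0 = 0")
    case True
    then have "x = scl 0 (\<lambda>i. r ^ i)"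
      using M_zero_iff[OF xM] by simp
    then have "(\<lambda>n. scl (inverse (real (Suc n))) (\<lambda>i. r ^ i)) \<longlonglongrightarrow> x"
      by (simp only:) (intro tendsto_scl LIMSEQ_inverse_real_of_nat)
    moreover have "\<forall>n. scl (inverse (real (Suc n))) (\<lambda>i. r ^ i) \<in> M"
      using scl_in_M[OF geometric_in_M] by (simp add: inverse_le_1_iff)
    ultimately have "\<forall>\<^sub>F n in sequentially. scl (inverse (real (Suc n))) (\<lambda>i. r ^ i) \<in> U"
      using openin_eventually_mem[OF assms(1) x] by blast
    then obtain n where "scl (inverse (real (Suc n))) (\<lambda>i. r ^ i) \<in> U"
      by (auto simp: eventually_sequentially)
    then show ?thesis
      by (intro bexI) auto
  qed (use x in auto)
qed

section \<open>Iterates of the shift and its failure to be injective\<close>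

lemma seq_shift_funpow: "(seq_shift ^^ n) x = (\<lambda>i. x (i + n))"
  by (induction n) (auto simp: seq_shift_def)

lemma continuous_on_seq_shift: "continuous_on S seq_shift"
  unfolding seq_shift_def by (intro continuous_intros)

lemma seq_shift_in_M: "x \<in> M \<Longrightarrow> seq_shift x \<in> M"
  unfolding M_iff seq_shift_def by blast

lemma not_inj_on_seq_shift: "\<not> inj_on seq_shift M"
proof
  assume inj: "inj_on seq_shift M"
  \<comment> \<open>The first coordinate is \<open>r\<close>, so its predecessors are 1 and
    \<open>r / \<rho>\<close>, distinct and both in [0,1].\<close>
  define x where "x = scl r (\<lambda>i. r ^ i)"
  have "x \<in> M"
    unfolding x_def using r_pos r_less_1 by (intro scl_in_M geometric_in_M) auto
  moreover have "x 0 / r \<le> 1" "x 0 / \<rho> \<le> 1"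
    using r_pos r_less_1 \<rho>_gt_1 by (simp_all add: x_def)
  ultimately have "prepend (x 0 / r) x \<in> M" "prepend (x 0 / \<rho>) x \<in> M"
    by (simp_all only: prepend_in_M simp_thms)
  moreover have "seq_shift (prepend (x 0 / r) x) = seq_shift (prepend (x 0 / \<rho>) x)"
    by simp
  ultimately have "prepend (x 0 / r) x = prepend (x 0 / \<rho>) x"
    using inj by (simp only: inj_onD)
  from fun_cong[OF this, of 0] have "x 0 / r = x 0 / \<rho>"
    by simp
  then show False
    using r_pos r_less_1 \<rho>_gt_1 by (simp add: x_def)
qed

end

section \<open>Density of the products \<open>r ^ k * \<rho> ^ l\<close>\<close>

text \<open>Logarithms turn this into inhomogeneous approximation by \<open>k * a - l * b\<close>
  with \<open>a / b\<close> irrational. Kronecker's theorem gives a positive \<open>k\<close> but an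
  integer \<open>h\<close> of unknown sign; replacing \<open>a / b\<close> by a large multiple makes
  \<open>h\<close> positive.\<close>

lemma NC_dense:
  assumes "NC r \<rho>" "0 < q" "0 < u" "u < v"
  shows "\<exists>k l. u < q * r ^ k * \<rho> ^ l \<and> q * r ^ k * \<rho> ^ l < v"
proof -
  have r: "0 < r" "r < 1" "1 < \<rho>"
    using assms(1) by (auto simp: NC_def)
  define a where "a = - ln r"
  define b where "b = ln \<rho>"
  have ab: "a > 0" "b > 0"
    using r by (auto simp: a_def b_def)
  \<comment> \<open>A fraction \<open>m / n\<close> would give
    \<open>r powi (- n) = \<rho> powi m\<close> with \<open>n > 0\<close>, against
    \<open>NC\<close>.\<close>
  have irrational: "a / b \<notin> \<rat>"
  proof
    assume "a / b \<in> \<rat>"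
    then obtain m n :: int where mn: "n > 0" "a / b = of_int m / of_int n"
      using Rats_cases' by blast
    then have "of_int n * a = of_int m * b"
      using ab by (simp add: field_simps)
    then have "exp (of_int (- n) * ln r) = exp (of_int m * ln \<rho>)"
      by (simp add: a_def b_def)
    then have "r powi (- n) = \<rho> powi m"
      using exp_power_int[of "ln r" "- n"] exp_power_int[of "ln \<rho>" m] r by simp
    then show False
      using assms(1) mn(1) by (auto simp: NC_def)
  qed
  \<comment> \<open>Half the logarithmic length of the interval in units of \<open>b\<close>, capped
    at 1 for the sake of the sign of \<open>h\<close>.\<close>
  define e where "e = min 1 ((ln v - ln u) / 2 / b)"
  \<comment> \<open>The signed distance from the logarithmic midpoint of the interval to
    \<open>ln q\<close>, in the same units.\<close>
  define c where "c = (ln q - (ln u + ln v) / 2) / b"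
  have e: "e > 0" "e \<le> 1" "e * b \<le> (ln v - ln u) / 2"
    using assms ab by (auto simp: e_def min_def field_simps)
  \<comment> \<open>For this \<open>N\<close> and any \<open>k \<ge> 1\<close>, an integer within
    \<open>e \<le> 1\<close> of \<open>k * N * (a / b) - c\<close> is positive.\<close>
  obtain N :: nat where N: "N * (a / b) > \<bar>c\<bar> + 1"
    using ab reals_Archimedean3[of "a / b"] by auto
  then have "N > 0"
    by (auto intro: gr0I)
  have "of_nat N * (a / b) \<notin> \<rat>"
  proof
    assume "of_nat N * (a / b) \<in> \<rat>"
    then have "of_nat N * (a / b) / of_nat N \<in> \<rat>"
      by (intro Rats_divide) auto
    then show False
      using irrational \<open>N > 0\<close> by simp
  qed
  then obtain h k :: int where k: "k > 0" and h: "\<bar>of_int k * (of_nat N * (a / b)) - of_int h - c\<bar> < e"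
    using sequence_of_fractional_parts_is_dense[OF _ e(1)] by metis
  have "of_nat N * (a / b) \<le> of_int k * (of_nat N * (a / b))"
    using k N mult_right_mono[of 1 "real_of_int k" "of_nat N * (a / b)"] by simp
  then have "of_int h > (0::real)"
    using h N e by linarith
  then have "h > 0"
    by simp
  define k' where "k' = nat k * N"
  define l where "l = nat h"
  have "real k' * a - real l * b - c * b = (of_int k * (of_nat N * (a / b)) - of_int h - c) * b"
    using k \<open>h > 0\<close> ab by (simp add: k'_def l_def field_simps)
  then have "\<bar>real k' * a - real l * b - c * b\<bar> < e * b"
    using h ab by (simp add: abs_mult)
  then have close: "\<bar>real k' * a - real l * b - (ln q - (ln u + ln v) / 2)\<bar> < (ln v - ln u) / 2"
    using e ab by (simp add: c_def)
  have "ln (q * r ^ k' * \<rho> ^ l) = ln q - real k' * a + real l * b"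
    using assms r by (simp add: ln_mult ln_realpow a_def b_def)
  then have "ln u < ln (q * r ^ k' * \<rho> ^ l)" "ln (q * r ^ k' * \<rho> ^ l) < ln v"
    using close by (auto simp: abs_if field_simps split: if_splits)
  moreover have "q * r ^ k' * \<rho> ^ l > 0"
    using assms r by simp
  ultimately show ?thesis
    using assms by auto
qed

section \<open>Transitivity and density of the end-points\<close>

locale NC_slopes =
  fixes r \<rho> :: real
  assumes NC: "NC r \<rho>"

sublocale NC_slopes \<subseteq> two_slopes
  using NC by unfold_locales (auto simp: NC_def)

context NC_slopes
begin

text \<open>The point \<open>y m\<close> copies \<open>x\<close> up to index \<open>m\<close> and
  then reaches \<open>scl t z\<close> by \<open>connect\<close>, where \<open>NC_dense\<close>
  provides a factor \<open>t\<close> within \<open>1 / (m + 1)\<close> of 1.\<close>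

lemma approach:
  assumes x: "x \<in> M" "x 0 \<noteq> 0" and z: "z \<in> M" "z 0 \<noteq> 0"
  shows "\<exists>y n. (\<forall>m. y m \<in> M) \<and> y \<longlonglongrightarrow> x \<and> (\<lambda>m. (seq_shift ^^ n m) (y m)) \<longlonglongrightarrow> z"
proof -
  have "\<exists>y n t. y \<in> M \<and> (\<forall>i\<le>m. y i = x i) \<and> 1 - inverse (real (Suc m)) \<le> t \<and> t \<le> 1 \<and>
      (seq_shift ^^ n) y = scl t z" for m
  proof -
    \<comment> \<open>The value 1/2 keeps the lower bound positive for \<open>NC_dense\<close>; at
      \<open>m = 0\<close> the other term is 0.\<close>
    define u where "u = max (1 - inverse (real (Suc m))) (1 / 2)"
    have "inverse (real (Suc m)) > 0"
      by simp
    then have "0 < u" "u < 1" "1 - inverse (real (Suc m)) \<le> u"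
      by (auto simp: u_def simp del: of_nat_Suc)
    moreover have "x m / z 0 > 0"
      using M_pos[OF x] M_pos[OF z] by simp
    ultimately obtain k l where kl: "u < x m / z 0 * r ^ k * \<rho> ^ l" "x m / z 0 * r ^ k * \<rho> ^ l < 1"
      using NC_dense[OF NC, of "x m / z 0" u 1] by blast
    define t where "t = x m / z 0 * r ^ k * \<rho> ^ l"
    have "x m * r ^ k * \<rho> ^ l = t * z 0"
      using z(2) by (simp add: t_def)
    then obtain y where "y \<in> M" "\<forall>i\<le>m. y i = x i" "\<forall>i. y (i + (m + k + l)) = t * z i"
      using connect[OF x(1) z(1), of t m k l] kl \<open>0 < u\<close> unfolding t_def by (meson less_imp_le less_trans)
    moreover from this(3) have "(seq_shift ^^ (m + k + l)) y = scl t z"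
      by (simp add: seq_shift_funpow scl_def)
    moreover have "1 - inverse (real (Suc m)) \<le> t" "t \<le> 1"
      using kl \<open>1 - inverse (real (Suc m)) \<le> u\<close> unfolding t_def by linarith+
    ultimately show ?thesis
      by blast
  qed
  then obtain y n t where y: "\<And>m. y m \<in> M" "\<And>m i. i \<le> m \<Longrightarrow> y m i = x i"
      "\<And>m. 1 - inverse (real (Suc m)) \<le> t m" "\<And>m. t m \<le> 1" "\<And>m. (seq_shift ^^ n m) (y m) = scl (t m) z"
    by metis
  have "y \<longlonglongrightarrow> x"
  proof (rule tendsto_coordinatewise_then_fun)
    fix i
    have "\<forall>\<^sub>F m in sequentially. y m i = x i"
      using y(2) unfolding eventually_sequentially by blast
    then show "(\<lambda>m. y m i) \<longlonglongrightarrow> x i"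
      by (rule tendsto_eventually)
  qed
  moreover have "t \<longlonglongrightarrow> 1"
  proof (rule tendsto_sandwich)
    show "(\<lambda>m. 1 - inverse (real (Suc m))) \<longlonglongrightarrow> 1"
      using tendsto_diff[OF tendsto_const LIMSEQ_inverse_real_of_nat, of 1] by (simp only: diff_0_right)
    show "\<forall>\<^sub>F m in sequentially. 1 - inverse (real (Suc m)) \<le> t m" "\<forall>\<^sub>F m in sequentially. t m \<le> 1"
      by (intro always_eventually allI y)+
  qed (rule tendsto_const)
  then have "(\<lambda>m. (seq_shift ^^ n m) (y m)) \<longlonglongrightarrow> z"
    unfolding y(5) using tendsto_scl[of t 1 sequentially z] by simp
  ultimately show ?thesis
    using y(1) by blast
qed

text \<open>With non-zero \<open>x\<close> in \<open>U\<close> and \<open>z\<close> in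
  \<open>V\<close>, \<open>approach\<close> gives points that are eventually in \<open>U\<close> and
  have iterates in \<open>V\<close>.\<close>

lemma transitive_seq_shift: "transitive_map M seq_shift"
  unfolding transitive_map_def
proof (intro conjI allI impI; (elim conjE)?)
  show "seq_shift ` M \<subseteq> M"
    using seq_shift_in_M by auto
next
  fix U V assume UV: "openin (top_of_set M) U" "U \<noteq> {}" "openin (top_of_set M) V" "V \<noteq> {}"
  obtain x where x: "x \<in> U" "x 0 \<noteq> 0"
    using nonzero_in_open[OF UV(1,2)] by auto
  obtain z where z: "z \<in> V" "z 0 \<noteq> 0"
    using nonzero_in_open[OF UV(3,4)] by auto
  have "x \<in> M" "z \<in> M"
    using x z openin_imp_subset[OF UV(1)] openin_imp_subset[OF UV(3)] by auto
  then obtain y n where y: "\<forall>m. y m \<in> M" "y \<longlonglongrightarrow> x" "(\<lambda>m. (seq_shift ^^ n m) (y m)) \<longlonglongrightarrow> z"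
    using approach x z by blast
  have "(seq_shift ^^ n) w \<in> M" if "w \<in> M" for n w
    by (induction n) (use that seq_shift_in_M in auto)
  then have "\<forall>\<^sub>F m in sequentially. (seq_shift ^^ n m) (y m) \<in> V"
    using openin_eventually_mem[OF UV(3) z(1) y(3)] y(1) by blast
  moreover have "\<forall>\<^sub>F m in sequentially. y m \<in> U"
    using openin_eventually_mem[OF UV(1) x(1) y(2,1)] .
  ultimately have "\<forall>\<^sub>F m in sequentially. y m \<in> U \<and> (seq_shift ^^ n m) (y m) \<in> V"
    by eventually_elim simp
  then obtain m where "y m \<in> U" "(seq_shift ^^ n m) (y m) \<in> V"
    unfolding eventually_sequentially by blast
  then show "\<exists>n. (seq_shift ^^ n) ` U \<inter> V \<noteq> {}"
    by blast
qed (rule continuous_on_seq_shift)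

text \<open>The points of \<open>M\<close> with supremum 1 form the intersection of the sets
  \<open>E m\<close>, each open and dense in the compact space \<open>M\<close>, so Baire's theorem
  applies.\<close>

lemma dense_end_points: "M \<subseteq> closure (end_points M)"
proof -
  define E where "E m = {x \<in> M. \<exists>i. x i > 1 - inverse (real (Suc m))}" for m
  \<comment> \<open>Any factor \<open>d > 1\<close> pushes some coordinate of such a point above 1,
    so its leg ends there.\<close>
  have E_end: "x \<in> end_points M" if x: "\<And>m. x \<in> E m" for x
  proof (rule end_pointI)
    show "x \<in> M"
      using x by (auto simp: E_def)
    show "x 0 \<noteq> 0"
    proof
      assume "x 0 = 0"
      then have "x = (\<lambda>_. 0)"
        using M_zero_iff[OF \<open>x \<in> M\<close>] by simp
      then show False
        using x[of 0] by (simp add: E_def)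
    qed
    show "scl d x \<notin> M" if "d > 1" for d
    proof
      assume "scl d x \<in> M"
      obtain m where "inverse (real (Suc m)) < 1 - inverse d"
        using reals_Archimedean[of "1 - inverse d"] \<open>d > 1\<close> inverse_less_1_iff[of d] by auto
      moreover obtain i where "x i > 1 - inverse (real (Suc m))"
        using x[of m] by (auto simp: E_def)
      ultimately have "x i > inverse d"
        by linarith
      then have "d * x i > 1"
        using \<open>d > 1\<close> by (simp add: field_simps)
      then show False
        using M_bounds(2)[OF \<open>scl d x \<in> M\<close>, of i] by simp
    qed
  qed
  have "top_of_set M closure_of \<Inter>(range E) = topspace (top_of_set M)"
  proof (rule Baire_category)
    show "completely_metrizable_space (top_of_set M) \<or>
        locally_compact_space (top_of_set M) \<and> regular_space (top_of_set M)"
      using compact_M by (intro disjI2 conjI compact_imp_locally_compact_space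
          regular_space_subtopology regular_space_euclidean)
        (simp add: compact_space_subtopology)
    fix T assume "T \<in> range E"
    then obtain m where T: "T = E m" by auto
    have "E m = M \<inter> (\<Union>i. {x. x i > 1 - inverse (real (Suc m))})"
      by (auto simp: E_def)
    moreover have "open (\<Union>i. {x :: nat \<Rightarrow> real. x i > 1 - inverse (real (Suc m))})"
      by (intro open_UN ballI open_Collect_less continuous_intros)
    ultimately have "openin (top_of_set M) (E m)"
      by (metis openin_open_Int)
    moreover have "top_of_set M closure_of E m = topspace (top_of_set M)"
      unfolding dense_intersects_open
    proof (intro allI impI, elim conjE)
      fix U assume U: "openin (top_of_set M) U" "U \<noteq> {}"
      then obtain x where x: "x \<in> U" "x 0 \<noteq> 0"
        using nonzero_in_open by blast
      then have "x \<in> M"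
        using openin_imp_subset[OF U(1)] by auto
      then obtain y n where y: "\<forall>m. y m \<in> M" "y \<longlonglongrightarrow> x"
          "(\<lambda>m. (seq_shift ^^ n m) (y m)) \<longlonglongrightarrow> (\<lambda>i. r ^ i)"
        using approach[of x "\<lambda>i. r ^ i"] x(2) geometric_in_M by auto
      \<comment> \<open>The target starts at 1, and the first coordinate of the shifted sequence is
        coordinate \<open>n k\<close> of \<open>y k\<close>, which thus comes close to 1.\<close>
      have "(\<lambda>m. (seq_shift ^^ n m) (y m) 0) \<longlonglongrightarrow> r ^ 0"
        using continuous_on_tendsto_compose[OF continuous_on_product_coordinates y(3), of 0] by simp
      then have "\<forall>\<^sub>F k in sequentially. (seq_shift ^^ n k) (y k) 0 > 1 - inverse (real (Suc m))"
        by (rule order_tendstoD) simp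
      moreover have "\<forall>\<^sub>F k in sequentially. y k \<in> U"
        using openin_eventually_mem[OF U(1) x(1) y(2,1)] .
      ultimately have "\<forall>\<^sub>F k in sequentially. y k \<in> U \<and> y k (n k) > 1 - inverse (real (Suc m))"
        by eventually_elim (simp add: seq_shift_funpow)
      then obtain k where "y k \<in> U" "y k (n k) > 1 - inverse (real (Suc m))"
        unfolding eventually_sequentially by blast
      then show "E m \<inter> U \<noteq> {}"
        using y(1) unfolding E_def by blast
    qed
    ultimately show "openin (top_of_set M) T \<and> top_of_set M closure_of T = topspace (top_of_set M)"
      unfolding T by blast
  qed simp
  then have "M \<subseteq> closure (M \<inter> \<Inter>(range E))"
    by (auto simp: closure_of_subtopology)
  also have "\<dots> \<subseteq> closure (end_points M)"
    using E_end by (intro closure_mono) auto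
  finally show ?thesis .
qed

lemma Lelek_fan_M: "Lelek_fan M"
  unfolding Lelek_fan_def fan_with_top_def
  using dendroid_M ramification_points_M smooth_M dense_end_points by blast

end

theorem mainTheorem4:
  fixes r \<rho> :: real
  assumes "NC r \<rho>"
  shows "Lelek_fan (M_space r \<rho>) \<and>
    transitive_map (M_space r \<rho>) seq_shift \<and>
    (\<exists>x\<in>M_space r \<rho>. x 0 / r \<noteq> x 0 / \<rho> \<and> x 0 / r \<in> {0..1} \<and> x 0 / \<rho> \<in> {0..1}) \<and>
    (\<forall>x\<in>M_space r \<rho>. x 0 / r \<noteq> x 0 / \<rho> \<and> x 0 / r \<in> {0..1} \<and> x 0 / \<rho> \<in> {0..1} \<longrightarrow>
       prepend (x 0 / r) x \<in> M_space r \<rho> \<and> seq_shift (prepend (x 0 / r) x) = x \<and>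
       prepend (x 0 / \<rho>) x \<in> M_space r \<rho> \<and> seq_shift (prepend (x 0 / \<rho>) x) = x) \<and>
    \<not> (\<exists>g. homeomorphism (M_space r \<rho>) (M_space r \<rho>) seq_shift g)"
proof -
  interpret NC_slopes r \<rho>
    by unfold_locales (rule assms)
  have ex: "\<exists>x\<in>M. x 0 / r \<noteq> x 0 / \<rho> \<and> x 0 / r \<in> {0..1} \<and> x 0 / \<rho> \<in> {0..1}"
  proof (rule bexI)
    show "scl r (\<lambda>i. r ^ i) \<in> M"
      using r_pos r_less_1 by (intro scl_in_M geometric_in_M) auto
  qed (use r_pos r_less_1 \<rho>_gt_1 in auto)
  have all: "prepend (x 0 / r) x \<in> M \<and> seq_shift (prepend (x 0 / r) x) = x \<and>
      prepend (x 0 / \<rho>) x \<in> M \<and> seq_shift (prepend (x 0 / \<rho>) x) = x"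
    if "x \<in> M" "x 0 / r \<in> {0..1}" "x 0 / \<rho> \<in> {0..1}" for x
    using that prepend_in_M[OF that(1)] by simp
  \<comment> \<open>An inverse \<open>g\<close> would make the shift injective on
    \<open>M\<close>.\<close>
  have "\<not> homeomorphism M M seq_shift g" for g
    using not_inj_on_seq_shift homeomorphism_apply1 inj_on_inverseI by metis
  then show ?thesis
    using Lelek_fan_M transitive_seq_shift ex all by blast
qed

end
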